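(* Let $\Lambda\subset\mathbb R^n$ be a full-rank lattice and let $K\subset\mathbb R^n$ be a minimal covering body with respect to $\Lambda$. Then $K$ is a polytope. Moreover, $K$ is the convex hull of translations of $\Lambda$-lattice polytopes.
   Context: A convex body in $\mathbb R^n$ is a compact convex set with nonempty interior. A convex body $K$ is a minimal covering body with respect to a full-rank lattice $\Lambda$ if $K+\Lambda=\mathbb R^n$ and no proper convex subbody $K'\subsetneq K$ (i.e. no convex body properly contained in $K$) satisfies $K'+\Lambda=\mathbb R^n$. A $\Lambda$-lattice polytope is the convex hull of finitely many points of $\Lambda$; it may have dimension less than $n$. A translation of such a polytope is by an arbitrary vector of $\mathbb R^n$. *)

theory Defs
  imports "HOL-Analysis.Analysis"
begin

definition full_rank_lattice :: "'a::euclidean_space set \<Rightarrow> bool" where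
  "full_rank_lattice \<Lambda> \<longleftrightarrow>
     (\<exists>B. independent B \<and> span B = UNIV \<and>
          \<Lambda> = {\<Sum>b\<in>B. of_int (c b) *\<^sub>R b | c :: 'a \<Rightarrow> int. True})"

definition convex_body :: "'a::euclidean_space set \<Rightarrow> bool" where
  "convex_body K \<longleftrightarrow> compact K \<and> convex K \<and> interior K \<noteq> {}"

definition lattice_covering :: "'a::euclidean_space set \<Rightarrow> 'a set \<Rightarrow> bool" where
  "lattice_covering \<Lambda> K \<longleftrightarrow> {x + l | x l. x \<in> K \<and> l \<in> \<Lambda>} = UNIV"

definition minimal_covering_body :: "'a::euclidean_space set \<Rightarrow> 'a set \<Rightarrow> bool" where
  "minimal_covering_body \<Lambda> K \<longleftrightarrow>
     convex_body K \<and> lattice_covering \<Lambda> K \<and>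
     (\<forall>K'. convex_body K' \<and> K' \<subset> K \<longrightarrow> \<not> lattice_covering \<Lambda> K')"

text \<open>No dimension is prescribed: a lattice polytope may be lower-dimensional, down to a
  single lattice point. It is never empty.\<close>

definition lattice_polytope :: "'a::euclidean_space set \<Rightarrow> 'a set \<Rightarrow> bool" where
  "lattice_polytope \<Lambda> P \<longleftrightarrow>
     (\<exists>V. finite V \<and> V \<noteq> {} \<and> V \<subseteq> \<Lambda> \<and> P = convex hull V)"

end

theory Submission
  imports Defs
begin

text \<open>A covering body contains a polytope that still covers, so a minimal one is itself a
  polytope. To find that polytope, take a box \<open>F\<close> that meets every coset of the lattice. Boundedness
  of \<open>K\<close> leaves only finitely many translates \<open>l + K\<close> that meet \<open>F\<close>, and these cover \<open>F\<close>. If each of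
  them can be shrunk to a polytope with \<open>F\<close> still covered, then moving these polytopes back into
  \<open>K\<close> and taking their convex hull gives a covering polytope inside \<open>K\<close>.

  The heart of the matter is therefore a statement without any lattice
  (\<open>polytope_refinable_of_closed_convex\<close>): if finitely many closed convex sets cover a polytope, then
  polytopes contained in them cover it too. The proof is by induction on the dimension of the
  covered polytope. The claim is local, by compactness and because the hull of finitely many
  polytopes inside a convex set is again a polytope inside it. Near a point \<open>x\<close> only those sets
  matter that contain \<open>x\<close>. On the facets of a small polytopal neighbourhood of \<open>x\<close> the dimension is
  smaller, so the sets can be refined there. Joining the refinements to \<open>x\<close> keeps them inside
  the given convex sets and fills the neighbourhood, since that is the union of the segments from
  \<open>x\<close> to its facets.

  The final claim on lattice polytopes follows at once:
  \<open>K\<close> is the hull of finitely many points, and a point is a translate of the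
  lattice polytope \<open>{0}\<close>.\<close>

section \<open>Refining convex coverings of polytopes\<close>

definition polytope_refinable :: "'a::euclidean_space set set \<Rightarrow> 'a set \<Rightarrow> bool" where
  "polytope_refinable \<C> F \<longleftrightarrow>
     (\<exists>Q. (\<forall>C\<in>\<C>. polytope (Q C) \<and> Q C \<subseteq> C) \<and> F \<subseteq> (\<Union>C\<in>\<C>. Q C))"

lemma polytope_convex_hull_Union:
  fixes \<P> :: "'a::euclidean_space set set"
  assumes "finite \<P>" "\<And>P. P \<in> \<P> \<Longrightarrow> polytope P"
  shows "polytope (convex hull (\<Union>\<P>))"
proof -
  obtain V where V: "\<And>P. P \<in> \<P> \<Longrightarrow> finite (V P) \<and> P = convex hull (V P)"
    using assms(2) unfolding polytope_def by metis
  have "convex hull (\<Union>\<P>) = convex hull (\<Union>P\<in>\<P>. V P)"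
  proof (rule antisym)
    have "P \<subseteq> convex hull (\<Union>P\<in>\<P>. V P)" if "P \<in> \<P>" for P
      using V[OF that] hull_mono[of "V P" "\<Union>P\<in>\<P>. V P" convex] that by blast
    then show "convex hull (\<Union>\<P>) \<subseteq> convex hull (\<Union>P\<in>\<P>. V P)"
      by (intro hull_minimal) auto
    have "V P \<subseteq> P" if "P \<in> \<P>" for P
      using V[OF that] hull_subset[of "V P" convex] by simp
    then show "convex hull (\<Union>P\<in>\<P>. V P) \<subseteq> convex hull (\<Union>\<P>)"
      by (intro hull_mono) blast
  qed
  then show ?thesis
    using V assms(1) by (auto intro!: polytope_convex_hull)
qed

lemma polytope_refinable_mono:
  assumes "polytope_refinable \<C> F" "\<C> \<subseteq> \<D>" "G \<subseteq> F"
  shows "polytope_refinable \<D> G"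
proof -
  obtain Q where Q: "\<forall>C\<in>\<C>. polytope (Q C) \<and> Q C \<subseteq> C" "F \<subseteq> (\<Union>C\<in>\<C>. Q C)"
    using assms(1) unfolding polytope_refinable_def by blast
  show ?thesis
    unfolding polytope_refinable_def
    using Q assms(2,3)
    by (intro exI[of _ "\<lambda>C. if C \<in> \<C> then Q C else {}"])
       (auto simp: polytope_empty dest!: subsetD)
qed

text \<open>Different refinements of the same convex set are merged by taking the hull of their union.\<close>

lemma polytope_refinable_Union:
  assumes "finite \<F>" and ref: "\<And>F. F \<in> \<F> \<Longrightarrow> polytope_refinable \<C> F"
    and conv: "\<And>C. C \<in> \<C> \<Longrightarrow> convex C"
  shows "polytope_refinable \<C> (\<Union>\<F>)"
proof -
  obtain Q where Q: "\<And>F C. F \<in> \<F> \<Longrightarrow> C \<in> \<C> \<Longrightarrow> polytope (Q F C) \<and> Q F C \<subseteq> C"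
      "\<And>F. F \<in> \<F> \<Longrightarrow> F \<subseteq> (\<Union>C\<in>\<C>. Q F C)"
    using ref unfolding polytope_refinable_def by metis
  define R where "R C = convex hull (\<Union>F\<in>\<F>. Q F C)" for C
  have "polytope (R C) \<and> R C \<subseteq> C" if "C \<in> \<C>" for C
  proof
    show "polytope (R C)"
      unfolding R_def using Q(1) that \<open>finite \<F>\<close> by (intro polytope_convex_hull_Union) auto
    show "R C \<subseteq> C"
      unfolding R_def using Q(1) that conv by (intro hull_minimal) auto
  qed
  moreover have "\<Union>\<F> \<subseteq> (\<Union>C\<in>\<C>. R C)"
  proof
    fix x assume "x \<in> \<Union>\<F>"
    then obtain F C where "F \<in> \<F>" "C \<in> \<C>" "x \<in> Q F C" using Q(2) by blast
    then have "x \<in> R C"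
      unfolding R_def by (intro hull_inc) blast
    then show "x \<in> (\<Union>C\<in>\<C>. R C)" using \<open>C \<in> \<C>\<close> by blast
  qed
  ultimately show ?thesis unfolding polytope_refinable_def by blast
qed

text \<open>The base point \<open>x\<close> may itself lie on the relative boundary, where a ray from \<open>x\<close> can leave
  at once; hence the exit point has to be sought beyond \<open>y\<close>, as the last point of the line
  through \<open>x\<close> and \<open>y\<close> that belongs to \<open>S\<close>.\<close>

lemma segment_extends_to_rel_boundary:
  fixes S :: "'a::euclidean_space set"
  assumes "compact S" "convex S" "x \<in> S" "y \<in> S" "x \<noteq> y"
  obtains z where "z \<in> S - rel_interior S" "y \<in> closed_segment x z"
proof -
  define T where "T = S \<inter> affine hull {x, y}"
  have "compact T"
    unfolding T_def by (simp add: assms(1) compact_Int_closed)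
  moreover have yT: "y \<in> T"
    unfolding T_def using assms by (simp add: hull_inc)
  moreover have "continuous_on T (\<lambda>w. (y - x) \<bullet> w)"
    by (intro continuous_intros)
  ultimately obtain z where z: "z \<in> T" and zmax: "\<And>w. w \<in> T \<Longrightarrow> (y - x) \<bullet> w \<le> (y - x) \<bullet> z"
    using continuous_attains_sup[of T "\<lambda>w. (y - x) \<bullet> w"] by blast
  obtain s t where st: "s + t = 1" "z = s *\<^sub>R x + t *\<^sub>R y"
    using z unfolding T_def affine_hull_2 by blast
  have zt: "z = x + t *\<^sub>R (y - x)"
  proof -
    have s: "s = 1 - t" using st(1) by simp
    show ?thesis unfolding st(2) s by (simp add: algebra_simps)
  qed
  have pos: "(y - x) \<bullet> (y - x) > 0" using assms(5) by simp
  have "t \<ge> 1"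
  proof -
    have "(y - x) \<bullet> y \<le> (y - x) \<bullet> x + t * ((y - x) \<bullet> (y - x))"
      using zmax[OF yT] unfolding zt by (simp add: inner_add_right)
    then have "1 * ((y - x) \<bullet> (y - x)) \<le> t * ((y - x) \<bullet> (y - x))"
      by (simp add: inner_diff_right)
    then show ?thesis using pos by (simp only: mult_le_cancel_right_pos)
  qed
  have "z \<notin> rel_interior S"
  proof
    assume "z \<in> rel_interior S"
    then obtain e where e: "e > 1" "(1 - e) *\<^sub>R x + e *\<^sub>R z \<in> S"
      using convex_rel_interior_iff[of S z] assms by blast
    define w where "w = (1 - e) *\<^sub>R x + e *\<^sub>R z"
    have w: "w = x + (e * t) *\<^sub>R (y - x)"
      unfolding w_def zt by (simp add: algebra_simps)
    have "w = (1 - e * t) *\<^sub>R x + (e * t) *\<^sub>R y"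
      unfolding w by (simp add: algebra_simps)
    then have "w \<in> affine hull {x, y}"
      unfolding affine_hull_2 by force
    then have "w \<in> T"
      using e(2) unfolding T_def w_def by blast
    then have "(e * t) * ((y - x) \<bullet> (y - x)) \<le> t * ((y - x) \<bullet> (y - x))"
      using zmax[of w] unfolding w zt by (simp add: inner_add_right)
    then have "e * t \<le> t" using pos by (simp only: mult_le_cancel_right_pos)
    then show False using \<open>t \<ge> 1\<close> e(1) by (simp add: mult_le_cancel_right2)
  qed
  moreover have "y \<in> closed_segment x z"
  proof -
    have "y = (1 - 1 / t) *\<^sub>R x + (1 / t) *\<^sub>R z"
      unfolding zt using \<open>t \<ge> 1\<close> by (simp add: algebra_simps)
    then show ?thesis
      unfolding closed_segment_def using \<open>t \<ge> 1\<close> by (auto intro!: exI[of _ "1 / t"])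
  qed
  ultimately show thesis using that z unfolding T_def by blast
qed

text \<open>Coning a refinement of the relative boundary from a point common to all the sets.\<close>

lemma polytope_refinable_cone:
  fixes G :: "'a::euclidean_space set"
  assumes "polytope G" "x \<in> G" "G \<subseteq> \<Union>\<C>"
    and conv: "\<And>C. C \<in> \<C> \<Longrightarrow> convex C" and x: "\<And>C. C \<in> \<C> \<Longrightarrow> x \<in> C"
    and bd: "polytope_refinable \<C> (G - rel_interior G)"
  shows "polytope_refinable \<C> G"
proof -
  obtain Q where Q: "\<And>C. C \<in> \<C> \<Longrightarrow> polytope (Q C) \<and> Q C \<subseteq> C"
      "G - rel_interior G \<subseteq> (\<Union>C\<in>\<C>. Q C)"
    using bd unfolding polytope_refinable_def by blast
  define R where "R C = convex hull (\<Union>{{x}, Q C})" for C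
  have "polytope (R C) \<and> R C \<subseteq> C" if "C \<in> \<C>" for C
  proof
    show "polytope (R C)"
      unfolding R_def using Q(1)[OF that] polytope_sing
      by (intro polytope_convex_hull_Union) auto
    show "R C \<subseteq> C"
      unfolding R_def using Q(1) that conv x by (intro hull_minimal) auto
  qed
  moreover have "G \<subseteq> (\<Union>C\<in>\<C>. R C)"
  proof
    fix y assume "y \<in> G"
    show "y \<in> (\<Union>C\<in>\<C>. R C)"
    proof (cases "y = x")
      case True
      then show ?thesis
        using assms(2,3) hull_inc[of x "\<Union>{{x}, Q _}" convex] unfolding R_def by blast
    next
      case False
      then obtain z where z: "z \<in> G - rel_interior G" "y \<in> closed_segment x z"
        using segment_extends_to_rel_boundary[of G x y] \<open>y \<in> G\<close> assms(1,2)
          polytope_imp_compact polytope_imp_convex by metis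
      then obtain C where C: "C \<in> \<C>" "z \<in> Q C" using Q(2) by blast
      have "x \<in> R C" "z \<in> R C"
        unfolding R_def using C by (auto intro: hull_inc)
      then have "closed_segment x z \<subseteq> R C"
        by (intro closed_segment_subset) (simp_all add: R_def)
      then show ?thesis using C z by blast
    qed
  qed
  ultimately show ?thesis unfolding polytope_refinable_def by blast
qed

text \<open>Closedness is what makes the claim local: sets that miss \<open>x\<close> keep a positive distance from it,
  so near \<open>x\<close> the sets through \<open>x\<close> cover by themselves. A single point has no facets, so the
  cone construction also settles the start of the induction.\<close>

theorem polytope_refinable_of_closed_convex:
  fixes F :: "'a::euclidean_space set"
  assumes "finite \<C>" "\<And>C. C \<in> \<C> \<Longrightarrow> closed C" "\<And>C. C \<in> \<C> \<Longrightarrow> convex C"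
    and "polytope F" "F \<subseteq> \<Union>\<C>"
  shows "polytope_refinable \<C> F"
  using assms
proof (induction "nat (aff_dim F + 1)" arbitrary: F \<C> rule: less_induct)
  case less
  have local: "\<exists>U. open U \<and> x \<in> U \<and> polytope_refinable \<C> (F \<inter> U)" if "x \<in> F" for x
  proof -
    define \<D> where "\<D> = {C \<in> \<C>. x \<in> C}"
    have \<D>: "finite \<D>" "\<And>C. C \<in> \<D> \<Longrightarrow> closed C" "\<And>C. C \<in> \<D> \<Longrightarrow> convex C"
      unfolding \<D>_def using less.prems by auto
    have "open (- \<Union>(\<C> - \<D>))" "x \<in> - \<Union>(\<C> - \<D>)"
      using less.prems(1,2) by (auto simp: \<D>_def intro!: closed_Union)
    then obtain a b where ab: "x \<in> box a b" "cbox a b \<subseteq> - \<Union>(\<C> - \<D>)"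
      using open_contains_cbox by metis
    define G where "G = F \<inter> cbox a b"
    have G: "polytope G"
      unfolding G_def using less.prems(4) polytope_interval[of a b]
      by (simp add: polytope_eq_bounded_polyhedron bounded_Int)
    have "x \<in> G" unfolding G_def using ab(1) that box_subset_cbox by blast
    have cover: "G \<subseteq> \<Union>\<D>" unfolding G_def using ab(2) less.prems(5) by blast
    have "polytope_refinable \<D> H" if H: "H facet_of G" for H
    proof (rule less.hyps)
      have "aff_dim G \<le> aff_dim F" unfolding G_def by (intro aff_dim_subset) blast
      moreover have "aff_dim H = aff_dim G - 1" "aff_dim H \<ge> 0"
        using H aff_dim_negative_iff[of H] by (auto simp: facet_of_def)
      ultimately show "nat (aff_dim H + 1) < nat (aff_dim F + 1)" by linarith
      show "polytope H"
        using face_of_polytope_polytope[OF G] facet_of_imp_face_of[OF H] by blast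
      show "H \<subseteq> \<Union>\<D>" using facet_of_imp_subset[OF H] cover by blast
    qed (use \<D> in auto)
    then have "polytope_refinable \<D> (\<Union>{H. H facet_of G})"
      using finite_polytope_facets[OF G] \<D>(3) by (intro polytope_refinable_Union) auto
    then have "polytope_refinable \<D> (G - rel_interior G)"
      using rel_boundary_of_polyhedron[of G] G polytope_imp_polyhedron by metis
    moreover have "x \<in> C" if "C \<in> \<D>" for C
      using that by (simp add: \<D>_def)
    ultimately have "polytope_refinable \<D> G"
      using polytope_refinable_cone[OF G \<open>x \<in> G\<close> cover \<D>(3)] by blast
    then have "polytope_refinable \<C> (F \<inter> box a b)"
      by (rule polytope_refinable_mono) (use box_subset_cbox in \<open>auto simp: \<D>_def G_def\<close>)
    then show ?thesis using ab(1) open_box by blast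
  qed
  then obtain U where U: "\<And>x. x \<in> F \<Longrightarrow> open (U x) \<and> x \<in> U x \<and> polytope_refinable \<C> (F \<inter> U x)"
    by metis
  obtain X where X: "X \<subseteq> F" "finite X" "F \<subseteq> (\<Union>x\<in>X. U x)"
    by (rule compactE_image[OF polytope_imp_compact[OF less.prems(4)], of F U]) (use U in auto)
  have "polytope_refinable \<C> (\<Union>((\<lambda>x. F \<inter> U x) ` X))"
    using X U less.prems(3) by (intro polytope_refinable_Union) auto
  then show ?case
    by (rule polytope_refinable_mono) (use X in auto)
qed

section \<open>Lattices\<close>

lemma full_rank_lattice_add:
  assumes "full_rank_lattice \<Lambda>" "l \<in> \<Lambda>" "m \<in> \<Lambda>"
  shows "l + m \<in> \<Lambda>"
proof -
  obtain B where B: "\<Lambda> = {\<Sum>b\<in>B. of_int (c b) *\<^sub>R b | c :: 'a \<Rightarrow> int. True}"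
    using assms(1) unfolding full_rank_lattice_def by blast
  obtain c d :: "'a \<Rightarrow> int" where
    "l = (\<Sum>b\<in>B. of_int (c b) *\<^sub>R b)" "m = (\<Sum>b\<in>B. of_int (d b) *\<^sub>R b)"
    using assms(2,3) unfolding B by blast
  then have "l + m = (\<Sum>b\<in>B. of_int (c b + d b) *\<^sub>R b)"
    by (simp add: sum.distrib scaleR_add_left)
  then show ?thesis unfolding B by (intro CollectI exI[of _ "\<lambda>b. c b + d b"]) simp
qed

lemma zero_in_full_rank_lattice:
  assumes "full_rank_lattice \<Lambda>"
  shows "0 \<in> \<Lambda>"
proof -
  obtain B where B: "\<Lambda> = {\<Sum>b\<in>B. of_int (c b) *\<^sub>R b | c :: 'a \<Rightarrow> int. True}"
    using assms unfolding full_rank_lattice_def by blast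
  show ?thesis unfolding B by (intro CollectI exI[of _ "\<lambda>_. 0"]) simp
qed

text \<open>The coordinates with respect to a basis are bounded linear functionals, so on a bounded set
  only finitely many integer coordinate vectors occur.\<close>

lemma finite_bounded_subset_of_lattice:
  fixes \<Lambda> :: "'a::euclidean_space set"
  assumes "full_rank_lattice \<Lambda>" "bounded S"
  shows "finite (\<Lambda> \<inter> S)"
proof -
  obtain B where B: "independent B" "span B = UNIV"
      "\<Lambda> = {\<Sum>b\<in>B. of_int (c b) *\<^sub>R b | c :: 'a \<Rightarrow> int. True}"
    using assms(1) unfolding full_rank_lattice_def by blast
  have "finite B" using B(1) independent_imp_finite by blast
  have coord: "representation B (\<Sum>b\<in>B. of_int (c b) *\<^sub>R b) b' = of_int (c b')"
    if "b' \<in> B" for c :: "'a \<Rightarrow> int" and b'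
  proof -
    have "representation B (\<Sum>b\<in>B. of_int (c b) *\<^sub>R b) b'
        = (\<Sum>b\<in>B. representation B (of_int (c b) *\<^sub>R b) b')"
      using B by (subst real_vector.representation_sum) auto
    also have "\<dots> = (\<Sum>b\<in>B. if b = b' then of_int (c b) else 0)"
      using B by (intro sum.cong) (auto simp: representation_scale representation_basis)
    finally show ?thesis using that \<open>finite B\<close> by simp
  qed
  have "\<exists>M::int. \<forall>v\<in>S. \<bar>representation B v b\<bar> \<le> of_int M" for b
  proof -
    have "linear (\<lambda>v. representation B v b)"
      using linear_representation[OF B(1,2)] by (simp add: linear_def real_scaleR_def[abs_def])
    then have "bounded ((\<lambda>v. representation B v b) ` S)"
      using bounded_linear_image[OF assms(2)] linear_conv_bounded_linear by blast
    then obtain M where M: "\<forall>v\<in>S. \<bar>representation B v b\<bar> \<le> M"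
      unfolding bounded_iff by auto
    have "\<forall>v\<in>S. \<bar>representation B v b\<bar> \<le> of_int \<lceil>M\<rceil>"
      using M le_of_int_ceiling order_trans by blast
    then show ?thesis by blast
  qed
  then obtain M :: "'a \<Rightarrow> int" where M: "\<And>b v. v \<in> S \<Longrightarrow> \<bar>representation B v b\<bar> \<le> of_int (M b)"
    by metis
  have "\<Lambda> \<inter> S \<subseteq> (\<lambda>c. \<Sum>b\<in>B. of_int (c b) *\<^sub>R b) ` (\<Pi>\<^sub>E b\<in>B. {- M b..M b})"
  proof
    fix l assume l: "l \<in> \<Lambda> \<inter> S"
    then obtain c :: "'a \<Rightarrow> int" where c: "l = (\<Sum>b\<in>B. of_int (c b) *\<^sub>R b)"
      unfolding B(3) by blast
    have "c b \<in> {- M b..M b}" if "b \<in> B" for b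
    proof -
      have "\<bar>of_int (c b) :: real\<bar> \<le> of_int (M b)"
        using M[of l b] coord[OF that, of c] l c by simp
      then have "\<bar>c b\<bar> \<le> M b" by linarith
      then show ?thesis by auto
    qed
    then have "restrict c B \<in> (\<Pi>\<^sub>E b\<in>B. {- M b..M b})" by auto
    moreover have "l = (\<Sum>b\<in>B. of_int (restrict c B b) *\<^sub>R b)" unfolding c by simp
    ultimately show "l \<in> (\<lambda>c. \<Sum>b\<in>B. of_int (c b) *\<^sub>R b) ` (\<Pi>\<^sub>E b\<in>B. {- M b..M b})"
      by blast
  qed
  moreover have "finite (\<Pi>\<^sub>E b\<in>B. {- M b..M b})"
    using \<open>finite B\<close> by (intro finite_PiE) auto
  ultimately show ?thesis using finite_surj by blast
qed

text \<open>Rounding down the coordinates moves any point into a half-open parallelepiped.\<close>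

lemma lattice_cosets_meet_box:
  fixes \<Lambda> :: "'a::euclidean_space set"
  assumes "full_rank_lattice \<Lambda>"
  obtains a where "\<And>x. \<exists>y\<in>cbox (- a) a. \<exists>l\<in>\<Lambda>. x = y + l"
proof -
  obtain B where B: "independent B" "span B = UNIV"
      "\<Lambda> = {\<Sum>b\<in>B. of_int (c b) *\<^sub>R b | c :: 'a \<Rightarrow> int. True}"
    using assms unfolding full_rank_lattice_def by blast
  have "finite B" using B(1) independent_imp_finite by blast
  obtain a where a: "cball 0 (\<Sum>b\<in>B. norm b) \<subseteq> cbox (- a) (a::'a)"
    using bounded_subset_cbox_symmetric[OF bounded_cball] by metis
  have "\<exists>y\<in>cbox (- a) a. \<exists>l\<in>\<Lambda>. x = y + l" for x
  proof -
    have "x \<in> span B" using B(2) by simp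
    then obtain r where r: "x = (\<Sum>b\<in>B. r b *\<^sub>R b)"
      using span_finite[OF \<open>finite B\<close>] by auto
    define y where "y = (\<Sum>b\<in>B. frac (r b) *\<^sub>R b)"
    define l where "l = (\<Sum>b\<in>B. of_int \<lfloor>r b\<rfloor> *\<^sub>R b)"
    have "norm y \<le> (\<Sum>b\<in>B. norm b)"
      unfolding y_def
    proof (rule sum_norm_le)
      fix b assume "b \<in> B"
      have "0 \<le> frac (r b)" "frac (r b) \<le> 1"
        using frac_lt_1[of "r b"] by auto
      then show "norm (frac (r b) *\<^sub>R b) \<le> norm b"
        by (simp add: mult_left_le_one_le)
    qed
    then have "y \<in> cbox (- a) a" using a by auto
    moreover have "l \<in> \<Lambda>" unfolding B(3) l_def by (auto intro!: exI[of _ "\<lambda>b. \<lfloor>r b\<rfloor>"])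
    moreover have "x = y + l"
      unfolding r y_def l_def
      by (simp add: sum.distrib[symmetric] scaleR_add_left[symmetric] frac_def)
    ultimately show ?thesis by blast
  qed
  then show thesis using that by blast
qed

section \<open>Minimal covering bodies\<close>

text \<open>The refined translates are brought back into \<open>K\<close> before taking the hull. A box \<open>N\<close> inside \<open>K\<close>
  is thrown in as well, so that the hull visibly has interior points.\<close>

lemma covering_body_contains_covering_polytope:
  fixes \<Lambda> K :: "'a::euclidean_space set"
  assumes \<Lambda>: "full_rank_lattice \<Lambda>" and K: "convex_body K" and cov: "lattice_covering \<Lambda> K"
  obtains P where "polytope P" "P \<subseteq> K" "convex_body P" "lattice_covering \<Lambda> P"
proof -
  have Kc: "compact K" "convex K" "interior K \<noteq> {}"
    using K unfolding convex_body_def by auto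
  obtain a where a: "\<And>x. \<exists>y\<in>cbox (- a) a. \<exists>l\<in>\<Lambda>. x = y + l"
    using lattice_cosets_meet_box[OF \<Lambda>] by metis
  define F where "F = cbox (- a) a"
  define L where "L = \<Lambda> \<inter> {y - k | y k. y \<in> F \<and> k \<in> K}"
  define \<C> where "\<C> = (\<lambda>l. (+) l ` K) ` L"
  have "compact {y - k | y k. y \<in> F \<and> k \<in> K}"
    using Kc(1) by (intro compact_differences) (simp_all add: F_def)
  then have "finite L"
    unfolding L_def by (intro finite_bounded_subset_of_lattice[OF \<Lambda>] compact_imp_bounded)
  have "F \<subseteq> \<Union>\<C>"
  proof
    fix y assume "y \<in> F"
    have "y \<in> {x + l | x l. x \<in> K \<and> l \<in> \<Lambda>}"
      using cov unfolding lattice_covering_def by simp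
    then obtain k l where kl: "y = k + l" "k \<in> K" "l \<in> \<Lambda>" by blast
    have "l = y - k" using kl(1) by simp
    then have "l \<in> L" unfolding L_def using kl \<open>y \<in> F\<close> by blast
    moreover have "y \<in> (+) l ` K" using kl by (auto simp: add.commute)
    ultimately show "y \<in> \<Union>\<C>" unfolding \<C>_def by blast
  qed
  then have "polytope_refinable \<C> F"
    using Kc \<open>finite L\<close> unfolding \<C>_def F_def
    by (intro polytope_refinable_of_closed_convex)
       (auto simp: polytope_interval intro!: compact_imp_closed compact_translation)
  then obtain Q where Q: "\<And>l. l \<in> L \<Longrightarrow> polytope (Q ((+) l ` K)) \<and> Q ((+) l ` K) \<subseteq> (+) l ` K"
      "F \<subseteq> (\<Union>l\<in>L. Q ((+) l ` K))"
    unfolding polytope_refinable_def \<C>_def by auto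
  define R where "R l = (+) (- l) ` Q ((+) l ` K)" for l
  have R: "polytope (R l)" "R l \<subseteq> K" if "l \<in> L" for l
  proof -
    show "polytope (R l)"
      using Q(1)[OF that] unfolding R_def by (simp only: polytope_translation_eq)
    show "R l \<subseteq> K"
      using Q(1)[OF that] unfolding R_def by auto
  qed
  obtain u v where uv: "box u v \<noteq> {}" "cbox u v \<subseteq> interior K"
    using Kc(3) open_contains_cbox[OF open_interior] by (metis empty_iff equals0I)
  define N where "N = cbox u v"
  define P where "P = convex hull (\<Union>(insert N (R ` L)))"
  have "polytope P"
    unfolding P_def using R(1) \<open>finite L\<close>
    by (intro polytope_convex_hull_Union) (auto simp: N_def polytope_interval)
  moreover have "P \<subseteq> K"
    unfolding P_def using R(2) Kc(2) uv(2) interior_subset[of K]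
    by (intro hull_minimal) (auto simp: N_def)
  moreover have subP: "N \<subseteq> P" "\<And>l. l \<in> L \<Longrightarrow> R l \<subseteq> P"
    unfolding P_def by (auto intro: hull_inc)
  moreover have "convex_body P"
  proof -
    have "box u v \<subseteq> interior P"
      using subP(1) box_subset_cbox[of u v] unfolding N_def by (intro interior_maximal) auto
    then show ?thesis
      using uv(1) \<open>polytope P\<close> polytope_imp_compact polytope_imp_convex
      unfolding convex_body_def by blast
  qed
  moreover have "lattice_covering \<Lambda> P"
    unfolding lattice_covering_def
  proof (intro equalityI subsetI UNIV_I)
    fix x :: 'a
    obtain y m where ym: "y \<in> F" "m \<in> \<Lambda>" "x = y + m" using a[of x] unfolding F_def by blast
    obtain l where l: "l \<in> L" "y \<in> Q ((+) l ` K)" using Q(2) ym(1) by blast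
    have "- l + y \<in> P" using subP(2)[OF l(1)] l(2) unfolding R_def by blast
    moreover have "l + m \<in> \<Lambda>"
      using l(1) ym(2) full_rank_lattice_add[OF \<Lambda>] unfolding L_def by blast
    moreover have "x = (- l + y) + (l + m)" using ym(3) by simp
    ultimately show "x \<in> {x + l | x l. x \<in> P \<and> l \<in> \<Lambda>}" by blast
  qed
  ultimately show thesis using that by blast
qed

theorem proposition3p3:
  fixes \<Lambda> K :: "(real ^ 'n) set"
  assumes "full_rank_lattice \<Lambda>"
    and "minimal_covering_body \<Lambda> K"
  shows "polytope K \<and>
    (\<exists>\<T>. finite \<T> \<and>
         (\<forall>T\<in>\<T>. \<exists>P t. lattice_polytope \<Lambda> P \<and> T = (\<lambda>x. t + x) ` P) \<and>
         K = convex hull (\<Union>\<T>))"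
proof -
  have K: "convex_body K" "lattice_covering \<Lambda> K"
    and min: "\<And>K'. convex_body K' \<Longrightarrow> K' \<subset> K \<Longrightarrow> \<not> lattice_covering \<Lambda> K'"
    using assms(2) unfolding minimal_covering_body_def by auto
  obtain P where P: "polytope P" "P \<subseteq> K" "convex_body P" "lattice_covering \<Lambda> P"
    using covering_body_contains_covering_polytope[OF assms(1) K] by blast
  have "P = K" using min[OF P(3)] P(2,4) by blast
  then have "polytope K" using P(1) by simp
  then obtain V where V: "finite V" "K = convex hull V" unfolding polytope_def by blast
  define \<T> where "\<T> = (\<lambda>v. {v}) ` V"
  have "lattice_polytope \<Lambda> {0}"
    unfolding lattice_polytope_def using zero_in_full_rank_lattice[OF assms(1)]
    by (intro exI[of _ "{0}"]) simp
  then have "\<forall>T\<in>\<T>. \<exists>P t. lattice_polytope \<Lambda> P \<and> T = (\<lambda>x. t + x) ` P"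
    unfolding \<T>_def by force
  moreover have "finite \<T>" "K = convex hull (\<Union>\<T>)"
    using V unfolding \<T>_def by auto
  ultimately show ?thesis using \<open>polytope K\<close> by blast
qed

end
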